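(* Let $\Gamma$ be a directed graph with vertex set $V(\Gamma)=\{v_1,\dots,v_n\}$ and let $P=(p_{ij})$ be its transition probability matrix. Suppose $P$ is irreducible, aperiodic, and has $n$ linearly independent eigenvectors. Let $C$ be an $n\times n$ matrix whose columns are unit-length (Euclidean norm $1$) eigenvectors of $P$ forming a basis of $\mathbb{C}^n$, so that $C$ is invertible and $C^{-1}PC$ is diagonal. Let $\boldsymbol{\pi}^T$ be the unique stationary distribution of $P$, and let $\rho$ be the maximum of $|\lambda|$ over the eigenvalues $\lambda$ of $P$ other than the dominant eigenvalue $1$. Then for any subsets $U,W\subseteq V(\Gamma)$, $$\left\lvert \sum_{\substack{v_i\in U\\ v_j\in W}} p_{ij} - |U|\,\pi(W)\right\rvert \le \rho\sqrt{\Big(\lVert C\rVert^2|U| - \frac{|U|^2}{n}\Big)\Big(\lVert C^{-1}\rVert^2|W| - \pi(W)^2 n\Big)}.$$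
   Context: The transition probability matrix $P$ of a directed graph $\Gamma$ with vertices $v_1,\dots,v_n$ is the $n\times n$ matrix with $p_{ij}=1/d^-(v_i)$ if $(v_i,v_j)$ is an edge of $\Gamma$ and $p_{ij}=0$ otherwise, where $d^-(v_i)$ is the outdegree of $v_i$. By the Perron–Frobenius theorem, when $P$ is irreducible and aperiodic its dominant eigenvalue is $1$, all other eigenvalues have modulus strictly less than $1$, and there is a unique stationary distribution $\boldsymbol{\pi}^T=(\pi_1,\dots,\pi_n)$ (a left eigenvector for eigenvalue $1$ with positive entries summing to $1$). For $U\subseteq V(\Gamma)$, $\pi(U)=\sum_{v_i\in U}\pi_i$. $\lVert\cdot\rVert$ denotes the operator norm induced by the Euclidean norm, $\lVert A\rVert=\sup_{\lVert x\rVert_2=1}\lVert Ax\rVert_2$. *)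

theory Defs
  imports "HOL-Analysis.Analysis" "Graph_Theory.Pair_Digraph"
begin

text \<open>
  Directed graphs have at most one arc per ordered pair of vertices, and loops are allowed.
  The map \<open>v\<close> enumerates the vertices by a finite index type.
\<close>

definition transition_matrix :: "'a pair_pre_digraph \<Rightarrow> ('n::finite \<Rightarrow> 'a) \<Rightarrow> real^'n^'n" where
  "transition_matrix G v =
     (\<chi> i j. if (v i, v j) \<in> parcs G then 1 / real (out_degree (with_proj G) (v i)) else 0)"

primrec matrix_power :: "real^'n^'n \<Rightarrow> nat \<Rightarrow> real^'n::finite^'n" where
  "matrix_power A 0 = mat 1"
| "matrix_power A (Suc k) = A ** matrix_power A k"

text \<open>The next two notions are meant for matrices with nonnegative entries.\<close>

definition irreducible_matrix :: "real^'n::finite^'n \<Rightarrow> bool" where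
  "irreducible_matrix A \<longleftrightarrow> (\<forall>i j. \<exists>k>0. matrix_power A k $ i $ j > 0)"

text \<open>
  Since \<open>Gcd {} = 0\<close>, an index without return times does not count as having period 1.
\<close>

definition aperiodic_matrix :: "real^'n::finite^'n \<Rightarrow> bool" where
  "aperiodic_matrix A \<longleftrightarrow> (\<forall>i. Gcd {k::nat. k > 0 \<and> matrix_power A k $ i $ i > 0} = 1)"

definition eigenvector :: "complex^'n::finite^'n \<Rightarrow> complex^'n \<Rightarrow> complex \<Rightarrow> bool" where
  "eigenvector A x l \<longleftrightarrow> x \<noteq> 0 \<and> A *v x = l *s x"

definition eigenvalue :: "complex^'n::finite^'n \<Rightarrow> complex \<Rightarrow> bool" where
  "eigenvalue A l \<longleftrightarrow> (\<exists>x. eigenvector A x l)"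

definition stationary_distribution :: "real^'n::finite^'n \<Rightarrow> real^'n \<Rightarrow> bool" where
  "stationary_distribution A p \<longleftrightarrow>
     p v* A = p \<and> (\<forall>i. p $ i > 0) \<and> (\<Sum>i\<in>UNIV. p $ i) = 1"

end

theory Submission
  imports Defs
begin

text \<open>
  Expand the indicator vector of \<open>W\<close> in the eigenbasis, with coefficients \<open>b = C\<^sup>-\<^sup>1 1\<^sub>W\<close>, and
  put \<open>a = C\<^sup>T 1\<^sub>U\<close>, so that the sum over \<open>U \<times> W\<close> becomes \<open>\<Sum>\<^sub>k \<lambda>\<^sub>k a\<^sub>k b\<^sub>k\<close>. Irreducibility makes the
  eigenvalue 1 simple with constant eigenvectors, so its column of \<open>C\<close> is constant with entries of
  modulus \<open>1 / \<surd>n\<close>; it contributes exactly \<open>|U| \<pi>(W)\<close>, since \<open>\<pi>\<close> annihilates all other eigenvectors.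
  The remaining terms are bounded by Cauchy-Schwarz, using \<open>|a| \<le> \<parallel>C\<parallel> \<surd>|U|\<close> and
  \<open>|b| \<le> \<parallel>C\<^sup>-\<^sup>1\<parallel> \<surd>|W|\<close> and removing the known dominant coordinate from both norms.
\<close>

section \<open>Row sums of the transition matrix\<close>

lemma transition_matrix_nonneg: "0 \<le> transition_matrix G v $ i $ j"
  by (simp add: transition_matrix_def)

lemma matrix_power_eq_zero_row:
  assumes "\<And>j. A $ i $ j = 0" and "k > 0"
  shows "matrix_power A k $ i $ j = 0"
  using assms by (cases k) (simp_all add: matrix_matrix_mult_def)

text \<open>A row can fail to sum to 1 only at a vertex without outgoing arcs. Irreducibility
  excludes such sinks: a zero row stays zero in every positive power, so no return would be
  possible.\<close>

lemma transition_matrix_row_sum: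
  fixes v :: "'n::finite \<Rightarrow> 'a"
  assumes G: "pair_fin_digraph G" and v: "bij_betw v UNIV (pverts G)"
    and irr: "irreducible_matrix (transition_matrix G v)"
  shows "(\<Sum>j\<in>UNIV. transition_matrix G v $ i $ j) = 1"
proof -
  interpret pair_fin_digraph G by (rule G)
  let ?N = "{j. (v i, v j) \<in> parcs G}"
  have inj: "inj v" and ran: "range v = pverts G"
    using v by (auto simp: bij_betw_def)
  have "out_arcs (with_proj G) (v i) = (\<lambda>j. (v i, v j)) ` ?N"
  proof (rule set_eqI)
    fix e
    show "e \<in> out_arcs (with_proj G) (v i) \<longleftrightarrow> e \<in> (\<lambda>j. (v i, v j)) ` ?N"
    proof
      assume "e \<in> out_arcs (with_proj G) (v i)"
      then have e: "e \<in> parcs G" "fst e = v i"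
        by (simp_all add: out_arcs_def)
      then have "snd e \<in> range v"
        using in_arcsD2[of "fst e" "snd e"] ran by simp
      with e show "e \<in> (\<lambda>j. (v i, v j)) ` ?N"
        by (cases e) auto
    qed (auto simp: out_arcs_def)
  qed
  moreover have "inj_on (\<lambda>j. (v i, v j)) ?N"
    using inj by (auto simp: inj_on_def)
  ultimately have deg: "out_degree (with_proj G) (v i) = card ?N"
    by (simp add: out_degree_def card_image)
  have "?N \<noteq> {}"
  proof
    assume "?N = {}"
    then have "\<And>j. transition_matrix G v $ i $ j = 0"
      by (auto simp: transition_matrix_def)
    moreover obtain k where "k > 0" "matrix_power (transition_matrix G v) k $ i $ i > 0"
      using irr by (auto simp: irreducible_matrix_def)
    ultimately show False
      using matrix_power_eq_zero_row[of "transition_matrix G v" i k i] by simp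
  qed
  then show ?thesis
    by (simp add: transition_matrix_def deg sum.If_cases)
qed

section \<open>Fixed vectors of irreducible stochastic matrices\<close>

lemma matrix_power_nonneg:
  assumes "\<And>i j. 0 \<le> A $ i $ j"
  shows "0 \<le> matrix_power A k $ i $ j"
proof (induction k arbitrary: i j)
  case 0
  then show ?case by (simp add: mat_def)
next
  case (Suc k)
  then show ?case
    using assms by (auto simp: matrix_matrix_mult_def intro!: sum_nonneg)
qed

lemma matrix_power_fixed_vector:
  assumes "A *v x = x"
  shows "matrix_power A k *v x = x"
  using assms by (induction k) (simp_all flip: matrix_vector_mul_assoc)

text \<open>Maximum principle: a harmonic function is constant along everything reachable from an argmax.\<close>

lemma irreducible_fixed_vector_constant:
  fixes A :: "real^'n::finite^'n"
  assumes nonneg: "\<And>i j. 0 \<le> A $ i $ j" and row: "\<And>i. (\<Sum>j\<in>UNIV. A $ i $ j) = 1"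
    and irr: "irreducible_matrix A" and x: "A *v x = x"
  shows "x $ i = x $ j"
proof -
  have one: "A *v 1 = 1"
    using row by (simp add: matrix_vector_mult_def vec_eq_iff)
  obtain m where m: "\<And>j. x $ j \<le> x $ m"
    using Max_in[of "range (($) x)"] Max_ge[of "range (($) x)"] by fastforce
  have "x $ j = x $ m" for j
  proof -
    obtain k where k: "matrix_power A k $ m $ j > 0"
      using irr by (auto simp: irreducible_matrix_def)
    let ?B = "matrix_power A k"
    have "?B *v 1 = 1" "?B *v x = x"
      using matrix_power_fixed_vector one x by auto
    then have "(\<Sum>j\<in>UNIV. ?B $ m $ j) = 1" "(\<Sum>j\<in>UNIV. ?B $ m $ j * x $ j) = x $ m"
      by (auto simp: matrix_vector_mult_def vec_eq_iff)
    \<comment> \<open>Row \<open>m\<close> of the power is a probability vector, so the gaps below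
      the maximum average to 0. Being nonnegative, every weighted gap vanishes, and the positive
      weight at \<open>j\<close> closes the gap there.\<close>
    then have "(\<Sum>j\<in>UNIV. ?B $ m $ j * (x $ m - x $ j)) = 0"
      by (simp add: right_diff_distrib sum_subtractf flip: sum_distrib_right)
    moreover have "\<forall>j\<in>UNIV. 0 \<le> ?B $ m $ j * (x $ m - x $ j)"
      using m matrix_power_nonneg[OF nonneg] by simp
    ultimately have "?B $ m $ j * (x $ m - x $ j) = 0"
      using sum_nonneg_eq_0_iff[of UNIV "\<lambda>j. ?B $ m $ j * (x $ m - x $ j)"] by auto
    with k show ?thesis by simp
  qed
  then show ?thesis by metis
qed

text \<open>A real matrix acts separately on real and imaginary parts, so both parts are fixed and
  the real case applies to each.\<close>

lemma irreducible_fixed_vector_constant_complex: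
  fixes A :: "real^'n::finite^'n"
  assumes nonneg: "\<And>i j. 0 \<le> A $ i $ j" and row: "\<And>i. (\<Sum>j\<in>UNIV. A $ i $ j) = 1"
    and irr: "irreducible_matrix A" and x: "map_matrix complex_of_real A *v x = x"
  shows "x $ i = x $ j"
proof -
  have "(\<Sum>j\<in>UNIV. complex_of_real (A $ i $ j) * x $ j) = x $ i" for i
    using x by (simp add: matrix_vector_mult_def vec_eq_iff)
  then have "Re (\<Sum>j\<in>UNIV. complex_of_real (A $ i $ j) * x $ j) = Re (x $ i)"
    "Im (\<Sum>j\<in>UNIV. complex_of_real (A $ i $ j) * x $ j) = Im (x $ i)" for i
    by simp_all
  then have "A *v (\<chi> i. Re (x $ i)) = (\<chi> i. Re (x $ i))"
    "A *v (\<chi> i. Im (x $ i)) = (\<chi> i. Im (x $ i))"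
    by (simp_all add: matrix_vector_mult_def vec_eq_iff)
  from this[THEN irreducible_fixed_vector_constant[OF nonneg row irr], of i j]
  show ?thesis by (simp add: complex_eq_iff)
qed

section \<open>Euclidean and operator norm estimates\<close>

lemma norm_vec_power2: "(norm x)\<^sup>2 = (\<Sum>i\<in>UNIV. (norm (x $ i))\<^sup>2)"
  for x :: "'a::real_normed_vector^'n::finite"
  by (simp add: norm_vec_def L2_set_def sum_nonneg)

lemma norm_sum_mult_le:
  fixes f g :: "'i \<Rightarrow> complex"
  shows "norm (\<Sum>i\<in>I. f i * g i) \<le> L2_set (\<lambda>i. norm (f i)) I * L2_set (\<lambda>i. norm (g i)) I"
proof -
  have "norm (\<Sum>i\<in>I. f i * g i) \<le> (\<Sum>i\<in>I. \<bar>norm (f i)\<bar> * \<bar>norm (g i)\<bar>)"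
    by (rule order_trans[OF norm_sum]) (simp add: norm_mult)
  also have "\<dots> \<le> L2_set (\<lambda>i. norm (f i)) I * L2_set (\<lambda>i. norm (g i)) I"
    by (rule L2_set_mult_ineq)
  finally show ?thesis .
qed

text \<open>Pairing \<open>z\<close>, the transpose applied to \<open>u\<close>, with its conjugate
  \<open>y\<close> moves \<open>C\<close> to the other side: the squared norm of \<open>z\<close>
  becomes the bilinear pairing of \<open>u\<close> with \<open>C *v y\<close>. Cauchy-Schwarz and
  cancelling one factor \<open>norm z\<close> finish.\<close>

lemma norm_transpose_mult_le:
  fixes C :: "complex^'n::finite^'m::finite"
  shows "norm (transpose C *v u) \<le> onorm ((*v) C) * norm u"
proof -
  define z where "z = transpose C *v u"
  define y where "y = (\<chi> k. cnj (z $ k))"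
  have y: "norm y = norm z"
    by (simp add: y_def norm_vec_def)
  have "complex_of_real ((norm z)\<^sup>2) = (\<Sum>k\<in>UNIV. z $ k * y $ k)"
    by (simp add: norm_vec_power2 y_def flip: complex_norm_square)
  also have "\<dots> = (\<Sum>k\<in>UNIV. \<Sum>i\<in>UNIV. C $ i $ k * u $ i * y $ k)"
    by (simp add: z_def matrix_vector_mult_def transpose_def sum_distrib_right)
  also have "\<dots> = (\<Sum>i\<in>UNIV. u $ i * (C *v y) $ i)"
    by (subst sum.swap) (simp add: matrix_vector_mult_def sum_distrib_left ac_simps)
  finally have "(norm z)\<^sup>2 = norm (\<Sum>i\<in>UNIV. u $ i * (C *v y) $ i)"
    by (metis norm_of_real abs_of_nonneg zero_le_power2)
  also have "\<dots> \<le> norm u * norm (C *v y)"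
    unfolding norm_vec_def by (rule norm_sum_mult_le)
  also have "\<dots> \<le> norm u * (onorm ((*v) C) * norm z)"
    using onorm[OF matrix_vector_mul_bounded_linear, of C y] y by (simp add: mult_left_mono)
  finally have le: "norm z * norm z \<le> (onorm ((*v) C) * norm u) * norm z"
    by (simp add: power2_eq_square ac_simps)
  have "0 \<le> onorm ((*v) C) * norm u"
    by (simp add: onorm_pos_le)
  with le have "norm z \<le> onorm ((*v) C) * norm u"
    by (cases "norm z = 0") (auto simp: mult_le_cancel_right)
  then show ?thesis by (simp add: z_def)
qed

section \<open>Coordinates in an eigenbasis\<close>

text \<open>\<open>matrix_inv\<close> is a choice term, so a two-sided inverse has to be exhibited
  first. Spanning columns give a right inverse, which is two-sided because \<open>C\<close> is
  square.\<close>

lemma matrix_inv_span_columns: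
  fixes C :: "'a::field^'n::finite^'n"
  assumes "vec.span (columns C) = UNIV"
  shows "C ** matrix_inv C = mat 1" and "matrix_inv C ** C = mat 1"
proof -
  have "\<exists>B. C ** B = mat 1 \<and> B ** C = mat 1"
    using assms matrix_right_invertible_span_columns matrix_left_right_inverse by blast
  from someI_ex[OF this] show "C ** matrix_inv C = mat 1" "matrix_inv C ** C = mat 1"
    by (simp_all add: matrix_inv_def)
qed

lemma matrix_mult_eigencolumns:
  fixes A C :: "'a::comm_semiring_1^'n::finite^'n"
  assumes "\<And>k. A *v column k C = lam k *s column k C"
  shows "(A ** C) $ i $ k = lam k * C $ i $ k"
  using assms[of k] by (simp add: vec_eq_iff matrix_vector_mult_def matrix_matrix_mult_def column_def)

text \<open>Applying \<open>A\<close> to \<open>x = C *v b\<close> multiplies coordinate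
  \<open>k\<close> of \<open>b\<close> by \<open>lam k\<close>, but also by \<open>l\<close>; the
  two factors agree wherever the coordinate is nonzero.\<close>

lemma eigenvalue_of_column:
  fixes A C :: "complex^'n::finite^'n"
  assumes span: "vec.span (columns C) = UNIV"
    and eig: "\<And>k. A *v column k C = lam k *s column k C"
    and x: "A *v x = l *s x" and nz: "(matrix_inv C *v x) $ k \<noteq> 0"
  shows "lam k = l"
proof -
  note inv = matrix_inv_span_columns[OF span]
  define b where "b = matrix_inv C *v x"
  have Cb: "C *v b = x"
    by (simp add: b_def matrix_vector_mul_assoc inv)
  have "C *v (\<chi> k. lam k * b $ k) = A *v (C *v b)"
    by (subst matrix_vector_mul_assoc) (simp add: vec_eq_iff matrix_vector_mult_def
        matrix_mult_eigencolumns[OF eig] ac_simps)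
  also have "\<dots> = C *v (l *s b)"
    by (simp add: Cb x vector_scalar_commute)
  finally have "matrix_inv C *v (C *v (\<chi> k. lam k * b $ k)) = matrix_inv C *v (C *v (l *s b))"
    by simp
  then have "(\<chi> k. lam k * b $ k) = l *s b"
    by (simp add: matrix_vector_mul_assoc inv)
  then have "lam k * b $ k = l * b $ k"
    by (simp add: vec_eq_iff)
  with nz show ?thesis by (simp add: b_def)
qed

lemma norm_indicator_vec_power2:
  "(norm ((\<chi> i. if i \<in> S then 1 else 0) :: complex^'n::finite))\<^sup>2 = real (card S)"
proof -
  have "(norm ((\<chi> i. if i \<in> S then 1 else 0) :: complex^'n))\<^sup>2
      = (\<Sum>i\<in>UNIV. if i \<in> S then 1 else 0)"
    unfolding norm_vec_power2 by (rule sum.cong) auto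
  then show ?thesis by (simp add: sum.If_cases)
qed

section \<open>The mixing bound for stochastic matrices\<close>

lemma stochastic_expander_mixing:
  fixes A :: "real^'n::finite^'n" and C :: "complex^'n^'n" and p :: "real^'n" and S T :: "'n set"
  assumes nonneg: "\<And>i j. 0 \<le> A $ i $ j" and row: "\<And>i. (\<Sum>j\<in>UNIV. A $ i $ j) = 1"
    and irr: "irreducible_matrix A"
    and eigvec: "\<And>k. \<exists>l. eigenvector (map_matrix complex_of_real A) (column k C) l"
    and unit: "\<And>k. norm (column k C) = 1"
    and span: "vec.span (columns C) = UNIV"
    and stat: "stationary_distribution A p"
    and \<rho>: "\<rho> = Max {cmod l | l. eigenvalue (map_matrix complex_of_real A) l \<and> l \<noteq> 1}"
  shows "\<bar>(\<Sum>i\<in>S. \<Sum>j\<in>T. A $ i $ j) - real (card S) * (\<Sum>j\<in>T. p $ j)\<bar>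
    \<le> \<rho> * sqrt
        (((onorm ((*v) C))\<^sup>2 * real (card S) - (real (card S))\<^sup>2 / real CARD('n)) *
         ((onorm ((*v) (matrix_inv C)))\<^sup>2 * real (card T)
            - (\<Sum>j\<in>T. p $ j)\<^sup>2 * real CARD('n)))"
proof -
  let ?A = "map_matrix complex_of_real A"
  let ?D = "matrix_inv C"
  note inv = matrix_inv_span_columns[OF span]
  obtain lam where "\<And>k. eigenvector ?A (column k C) (lam k)"
    using eigvec by metis
  then have eig: "\<And>k. ?A *v column k C = lam k *s column k C" and ev: "\<And>k. eigenvalue ?A (lam k)"
    by (auto simp: eigenvector_def eigenvalue_def)
  have mult_nz: "D *v x \<noteq> 0" if "E ** D = mat 1" "x \<noteq> 0" for D E :: "complex^'n^'n" and x
    using that by (metis matrix_vector_mul_assoc matrix_vector_mul_lid matrix_vector_mult_0_right)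

  have eigenvalues: "l \<in> range lam" if l: "eigenvalue ?A l" for l
  proof -
    obtain x where x: "x \<noteq> 0" "?A *v x = l *s x"
      using l by (auto simp: eigenvalue_def eigenvector_def)
    then obtain k where "(?D *v x) $ k \<noteq> 0"
      using mult_nz[OF inv(1)] by (auto simp: vec_eq_iff)
    then show ?thesis
      using eigenvalue_of_column[OF span eig x(2)] by auto
  qed
  \<comment> \<open>Finiteness is what makes \<open>Max\<close> an upper bound for the moduli; it
    holds because the columns already realise every eigenvalue.\<close>
  then have "{cmod l | l. eigenvalue ?A l \<and> l \<noteq> 1} \<subseteq> cmod ` range lam"
    by auto
  then have "finite {cmod l | l. eigenvalue ?A l \<and> l \<noteq> 1}"
    by (rule finite_subset) simp
  then have le_\<rho>: "cmod (lam k) \<le> \<rho>" if "lam k \<noteq> 1" for k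
    unfolding \<rho> using that ev by (intro Max_ge) auto

  have one: "?A *v 1 = 1 *s 1"
    using row by (simp add: vec_eq_iff matrix_vector_mult_def flip: of_real_sum)
  \<comment> \<open>The all-ones vector has some nonzero coordinate in the eigenbasis; the
    corresponding column \<open>k0\<close> must have eigenvalue 1.\<close>
  have "?D *v 1 \<noteq> 0"
    by (rule mult_nz[OF inv(1)]) (simp add: vec_eq_iff)
  then obtain k0 where "(?D *v 1) $ k0 \<noteq> 0"
    by (auto simp: vec_eq_iff)
  then have lam0: "lam k0 = 1"
    by (rule eigenvalue_of_column[OF span eig one])
  have const: "C $ i $ k = C $ j $ k" if "lam k = 1" for i j k
    using irreducible_fixed_vector_constant_complex[OF nonneg row irr, of "column k C" i j] eig[of k] that
    by (simp add: column_def)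
  \<comment> \<open>\<open>undefined\<close> serves as an arbitrary row index, since the column is
    constant.\<close>
  define c where "c = C $ undefined $ k0"
  have c: "C $ i $ k0 = c" for i
    unfolding c_def by (rule const[OF lam0])
  have normc: "(cmod c)\<^sup>2 * real CARD('n) = 1"
    using unit[of k0] norm_vec_power2[of "column k0 C"] by (simp add: column_def c mult.commute)
  then have c0: "c \<noteq> 0" by auto
  \<comment> \<open>A second column with eigenvalue 1 would also be constant, hence a multiple of
    column \<open>k0\<close>, contradicting the injectivity of \<open>C\<close>.\<close>
  have lam_ne: "lam k \<noteq> 1" if "k \<noteq> k0" for k
  proof
    assume k: "lam k = 1"
    define d where "d = C $ undefined $ k"
    have d: "C $ i $ k = d" for i
      unfolding d_def by (rule const[OF k])
    have "(C *v axis j 1) $ i = C $ i $ j" for i j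
      by (simp add: matrix_vector_mult_def axis_def if_distrib cong: if_cong)
    then have "C *v (axis k 1 - (d / c) *s axis k0 1) = 0"
      using c0 by (simp add: vec_eq_iff matrix_vector_mult_diff_distrib vector_scalar_commute c d)
    then have "axis k 1 - (d / c) *s axis k0 1 = (0 :: complex^'n)"
      using mult_nz[OF inv(2)] by blast
    then have "(axis k 1 - (d / c) *s axis k0 1) $ k = (0 :: complex)"
      by simp
    with that show False by (simp add: axis_def)
  qed

  define u :: "complex^'n" where "u = (\<chi> i. if i \<in> S then 1 else 0)"
  define w :: "complex^'n" where "w = (\<chi> i. if i \<in> T then 1 else 0)"
  define a where "a = transpose C *v u"
  define b where "b = ?D *v w"
  have Cb: "C *v b = w"
    by (simp add: b_def matrix_vector_mul_assoc inv)
  have a_sum: "a $ k = (\<Sum>i\<in>S. C $ i $ k)" for k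
    by (simp add: a_def u_def matrix_vector_mult_def transpose_def if_distrib sum.If_cases cong: if_cong)
  have a0: "a $ k0 = c * of_nat (card S)"
    by (simp add: a_sum c)

  have p_row: "(\<Sum>i\<in>UNIV. p $ i * A $ i $ j) = p $ j" for j
    using stat by (simp add: stationary_distribution_def vector_matrix_mult_def vec_eq_iff ac_simps)
  \<comment> \<open>\<open>y\<close> is the row vector \<open>p\<close> times \<open>C\<close>.
    Multiplying it by the eigenvalues amounts to inserting \<open>A\<close>, which \<open>p\<close>
    absorbs, so \<open>y\<close> can be nonzero only at \<open>k0\<close>.\<close>
  define y where "y k = (\<Sum>i\<in>UNIV. complex_of_real (p $ i) * C $ i $ k)" for k
  have y_lam: "y k * lam k = y k" for k
  proof -
    have "y k * lam k = (\<Sum>i\<in>UNIV. complex_of_real (p $ i) * (?A ** C) $ i $ k)"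
      by (simp add: y_def matrix_mult_eigencolumns[OF eig] sum_distrib_left ac_simps)
    also have "\<dots> = (\<Sum>j\<in>UNIV. (\<Sum>i\<in>UNIV. complex_of_real (p $ i) * complex_of_real (A $ i $ j)) * C $ j $ k)"
      unfolding matrix_matrix_mult_def
      by (simp add: sum_distrib_left sum_distrib_right mult.assoc) (rule sum.swap)
    also have "\<dots> = y k"
      by (simp add: y_def p_row flip: of_real_mult of_real_sum)
    finally show ?thesis .
  qed
  have y_ne: "y k = 0" if "k \<noteq> k0" for k
    using y_lam[of k] lam_ne[OF that] by simp
  have y0: "y k0 = c"
    using stat by (simp add: y_def c stationary_distribution_def flip: of_real_sum sum_distrib_right)
  have "complex_of_real (\<Sum>j\<in>T. p $ j) = (\<Sum>i\<in>UNIV. complex_of_real (p $ i) * w $ i)"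
    by (simp add: w_def if_distrib sum.If_cases cong: if_cong)
  also have "\<dots> = (\<Sum>k\<in>UNIV. y k * b $ k)"
    unfolding Cb[symmetric] y_def matrix_vector_mult_def
    by (simp add: sum_distrib_left sum_distrib_right mult.assoc) (rule sum.swap)
  also have "\<dots> = c * b $ k0"
    using y_ne by (subst sum.remove[of _ k0]) (auto simp: y0)
  finally have b0: "c * b $ k0 = complex_of_real (\<Sum>j\<in>T. p $ j)" ..

  define f where "f = (onorm ((*v) C))\<^sup>2 * real (card S) - (real (card S))\<^sup>2 / real CARD('n)"
  define g where "g = (onorm ((*v) ?D))\<^sup>2 * real (card T) - (\<Sum>j\<in>T. p $ j)\<^sup>2 * real CARD('n)"
  let ?K = "UNIV - {k0}"
  have cmod_c: "(cmod c)\<^sup>2 = 1 / real CARD('n)"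
    using normc by (simp add: field_simps)
  \<comment> \<open>The subtracted terms in \<open>f\<close> and \<open>g\<close> are exactly the
    squared moduli of \<open>a $ k0\<close> and \<open>b $ k0\<close>, so \<open>f\<close> and
    \<open>g\<close> bound the remaining squares.\<close>
  have split: "(norm x)\<^sup>2 = (cmod (x $ k0))\<^sup>2 + (\<Sum>k\<in>?K. (cmod (x $ k))\<^sup>2)" for x :: "complex^'n"
    unfolding norm_vec_power2 by (rule sum.remove) auto
  have "(norm a)\<^sup>2 \<le> (onorm ((*v) C))\<^sup>2 * real (card S)"
    using power_mono[OF norm_transpose_mult_le[of C u] norm_ge_zero, of 2]
    by (simp add: a_def power_mult_distrib norm_indicator_vec_power2 u_def)
  then have f: "(\<Sum>k\<in>?K. (cmod (a $ k))\<^sup>2) \<le> f"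
    using split[of a] by (simp add: f_def a0 norm_mult power_mult_distrib cmod_c)
  have "(norm b)\<^sup>2 \<le> (onorm ((*v) ?D))\<^sup>2 * real (card T)"
    using power_mono[OF onorm[OF matrix_vector_mul_bounded_linear, of ?D w] norm_ge_zero, of 2]
    by (simp add: b_def power_mult_distrib norm_indicator_vec_power2 w_def)
  moreover have "(cmod (b $ k0))\<^sup>2 = (\<Sum>j\<in>T. p $ j)\<^sup>2 * real CARD('n)"
  proof -
    have "(cmod c)\<^sup>2 * (cmod (b $ k0))\<^sup>2 = (\<Sum>j\<in>T. p $ j)\<^sup>2"
      using arg_cong[OF b0, of "\<lambda>z. (cmod z)\<^sup>2"]
      by (simp only: norm_mult power_mult_distrib norm_of_real power2_abs)
    then show ?thesis by (simp add: cmod_c field_simps)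
  qed
  ultimately have g: "(\<Sum>k\<in>?K. (cmod (b $ k))\<^sup>2) \<le> g"
    using split[of b] by (simp add: g_def)
  have f0: "0 \<le> f" and g0: "0 \<le> g"
    using f g by (meson order_trans sum_nonneg zero_le_power2)+

  have "complex_of_real (\<Sum>i\<in>S. \<Sum>j\<in>T. A $ i $ j) = (\<Sum>i\<in>S. (?A *v w) $ i)"
    by (simp add: w_def matrix_vector_mult_def if_distrib sum.If_cases cong: if_cong)
  also have "\<dots> = (\<Sum>i\<in>S. \<Sum>k\<in>UNIV. lam k * C $ i $ k * b $ k)"
    unfolding Cb[symmetric] matrix_vector_mul_assoc
    by (simp add: matrix_vector_mult_def matrix_mult_eigencolumns[OF eig])
  also have "\<dots> = (\<Sum>k\<in>UNIV. (lam k * a $ k) * b $ k)"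
    unfolding a_sum by (subst sum.swap) (simp add: sum_distrib_left sum_distrib_right)
  also have "\<dots> = a $ k0 * b $ k0 + (\<Sum>k\<in>?K. (lam k * a $ k) * b $ k)"
    by (subst sum.remove[of _ k0]) (auto simp: lam0)
  also have "a $ k0 * b $ k0 = complex_of_real (real (card S) * (\<Sum>j\<in>T. p $ j))"
    using b0 by (simp add: a0 ac_simps)
  finally have diff: "complex_of_real ((\<Sum>i\<in>S. \<Sum>j\<in>T. A $ i $ j) - real (card S) * (\<Sum>j\<in>T. p $ j))
      = (\<Sum>k\<in>?K. (lam k * a $ k) * b $ k)"
    by (simp only: of_real_diff add_diff_cancel_left')
  have abs_eq: "\<bar>(\<Sum>i\<in>S. \<Sum>j\<in>T. A $ i $ j) - real (card S) * (\<Sum>j\<in>T. p $ j)\<bar>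
      = cmod (\<Sum>k\<in>?K. (lam k * a $ k) * b $ k)"
    using arg_cong[OF diff, of cmod] by (simp only: norm_of_real)
  have "cmod (\<Sum>k\<in>?K. (lam k * a $ k) * b $ k) \<le> \<rho> * sqrt (f * g)"
  proof (cases "?K = {}")
    case True
    \<comment> \<open>Here \<open>\<rho>\<close> is the junk value \<open>Max {}\<close>, so the square root has to vanish.\<close>
    then have univ: "UNIV = {k0}" by auto
    then have card1: "CARD('n) = 1" by (metis card_1_singleton_iff One_nat_def)
    \<comment> \<open>With one index, \<open>C\<close> is multiplication by a number of modulus 1.
      As the size of \<open>S\<close> is 0 or 1, it equals its square, so \<open>f\<close> cannot be
      positive.\<close>
    have "norm (C *v x) \<le> 1 * norm x" for x
      using normc by (simp add: norm_vec_def L2_set_def matrix_vector_mult_def univ c norm_mult card1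
          power_mult_distrib)
    then have "onorm ((*v) C) \<le> 1"
      by (intro onorm_le) auto
    then have "(onorm ((*v) C))\<^sup>2 \<le> 1"
      by (simp add: onorm_pos_le power_le_one)
    moreover have "card S = 0 \<or> card S = 1"
      using card_mono[of UNIV S] card1 by (simp add: le_Suc_eq)
    ultimately have "f \<le> 0"
      by (auto simp: f_def card1)
    with f0 have "f = 0" by simp
    then show ?thesis by (simp add: True)
  next
    case False
    \<comment> \<open>A second index supplies an eigenvalue other than 1, which makes
      \<open>\<rho>\<close> nonnegative.\<close>
    then obtain k1 where "k1 \<noteq> k0" by auto
    then have "cmod (lam k1) \<le> \<rho>" by (intro le_\<rho> lam_ne)
    then have \<rho>0: "0 \<le> \<rho>" using norm_ge_zero order_trans by blast
    have "L2_set (\<lambda>k. cmod (lam k * a $ k)) ?K \<le> L2_set (\<lambda>k. \<rho> * cmod (a $ k)) ?K"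
      by (rule L2_set_mono) (auto simp: norm_mult intro!: mult_right_mono le_\<rho> lam_ne)
    also have "\<dots> = \<rho> * L2_set (\<lambda>k. cmod (a $ k)) ?K"
      using \<rho>0 by (simp add: L2_set_right_distrib)
    also have "\<dots> \<le> \<rho> * sqrt f"
      using f \<rho>0 by (simp add: L2_set_def mult_left_mono)
    finally have 1: "L2_set (\<lambda>k. cmod (lam k * a $ k)) ?K \<le> \<rho> * sqrt f" .
    have 2: "L2_set (\<lambda>k. cmod (b $ k)) ?K \<le> sqrt g"
      using g by (simp add: L2_set_def)
    have "cmod (\<Sum>k\<in>?K. (lam k * a $ k) * b $ k)
        \<le> L2_set (\<lambda>k. cmod (lam k * a $ k)) ?K * L2_set (\<lambda>k. cmod (b $ k)) ?K"
      by (rule norm_sum_mult_le)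
    also have "\<dots> \<le> \<rho> * sqrt f * sqrt g"
      using 1 2 \<rho>0 f0 by (intro mult_mono) (auto simp: L2_set_nonneg)
    finally show ?thesis by (simp add: real_sqrt_mult)
  qed
  then show ?thesis
    unfolding abs_eq f_def g_def .
qed

section \<open>Transfer from vertex sets to index sets\<close>

theorem theorem3p1:
  fixes G :: "'a pair_pre_digraph"
    and v :: "'n::finite \<Rightarrow> 'a"
    and P :: "real^'n^'n"
    and Pc C :: "complex^'n^'n"
    and \<pi> :: "real^'n"
    and \<rho> :: real
    and U W :: "'a set"
  assumes "pair_fin_digraph G"
    and "bij_betw v UNIV (pverts G)"
    and "P = transition_matrix G v"
    and "Pc = map_matrix complex_of_real P"
    and "irreducible_matrix P"
    and "aperiodic_matrix P"
    and "\<exists>B. card B = CARD('n) \<and> vec.independent B \<and> (\<forall>x\<in>B. \<exists>l. eigenvector Pc x l)"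
    and "\<And>j. \<exists>l. eigenvector Pc (column j C) l"
    and "\<And>j. norm (column j C) = 1"
    and "inj (\<lambda>j. column j C)"
    and "vec.independent (columns C)"
    and "vec.span (columns C) = UNIV"
    and "stationary_distribution P \<pi>"
    and "\<rho> = Max {cmod l | l. eigenvalue Pc l \<and> l \<noteq> 1}"
    and "U \<subseteq> pverts G"
    and "W \<subseteq> pverts G"
  shows "\<bar>(\<Sum>i | v i \<in> U. \<Sum>j | v j \<in> W. P $ i $ j)
            - real (card U) * (\<Sum>j | v j \<in> W. \<pi> $ j)\<bar>
    \<le> \<rho> * sqrt
        (((onorm ((*v) C))\<^sup>2 * real (card U) - (real (card U))\<^sup>2 / real CARD('n)) *
         ((onorm ((*v) (matrix_inv C)))\<^sup>2 * real (card W)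
            - (\<Sum>j | v j \<in> W. \<pi> $ j)\<^sup>2 * real CARD('n)))"
proof -
  have inj: "inj v" and ran: "range v = pverts G"
    using assms(2) by (auto simp: bij_betw_def)
  have card: "card {i. v i \<in> X} = card X" if "X \<subseteq> pverts G" for X
    using card_vimage_inj[OF inj, of X] that ran by (simp add: vimage_def)
  have nonneg: "\<And>i j. 0 \<le> P $ i $ j"
    unfolding assms(3) by (rule transition_matrix_nonneg)
  have row: "\<And>i. (\<Sum>j\<in>UNIV. P $ i $ j) = 1"
    using transition_matrix_row_sum assms(1,2,3,5) by blast
  show ?thesis
    using stochastic_expander_mixing[OF nonneg row assms(5) assms(8)[unfolded assms(4)] assms(9,12,13)
        assms(14)[unfolded assms(4)], where S = "{i. v i \<in> U}" and T = "{i. v i \<in> W}"]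
    by (simp only: card assms(15,16))
qed

end
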